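(* Let $p\geq 2$ be an even integer and let $G=(V,E)$ be a $(p,2)$-flex-connected graph with unsafe edge set $\mathcal{U}\subseteq E$. Let $\mathcal{F}$ be the family of violated sets of $G$. Then $\mathcal{F}$ is a pliable family, and $\mathcal{F}$ satisfies property $\gamma$.
   Context: $G=(V,E)$ is a finite graph (parallel edges allowed) whose edge set is partitioned into safe edges and unsafe edges; $\mathcal{U}$ denotes the set of unsafe edges. For $S\subseteq V$, $\delta(S)$ is the set of edges with exactly one endpoint in $S$. $G$ is $(p,2)$-flex-connected if for every $F\subseteq\mathcal{U}$ with $|F|\leq 2$ the graph $(V,E\setminus F)$ is $p$-edge-connected. A set $S\subseteq V$ is violated if $|\delta(S)|=p+2$ and $\delta(S)$ contains at least $3$ unsafe edges. Two sets $A,B\subseteq V$ cross if all four of $A\setminus B$, $A\cap B$, $B\setminus A$, $V\setminus(A\cup B)$ are nonempty. A family $\mathcal{F}\subseteq 2^V$ is pliable if for all $A,B\in\mathcal{F}$, $|\{A\cup B, A\cap B, A\setminus B, B\setminus A\}\cap\mathcal{F}|\geq 2$. A family $\mathcal{F}$ satisfies property $\gamma$ if for every set of vertex pairs $F'\subseteq V\times V$, letting $\mathcal{F}'=\{S\in\mathcal{F}: \text{no pair in } F' \text{ has exactly one endpoint in } S\}$, the following holds: whenever $C,S_1,S_2\in\mathcal{F}'$, $C$ is inclusion-wise minimal in $\mathcal{F}'$, $C$ crosses both $S_1$ and $S_2$, and $S_1\subseteq S_2$, the set $S_2\setminus(S_1\cup C)$ is either empty or violated (i.e. belongs to $\mathc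al{F}$).
   Formalization: In the definition of pliable, the four sets A∪B, A∩B, A\B, B\A are counted with multiplicity; counting distinct sets fails for A = B (only A would be counted, as the empty set is never violated), while for A ≠ B the two counts agree. *)

theory Defs
  imports Main
begin

text \<open>
  An undirected multigraph is given by a vertex set, an edge set and a map sending each edge
  to its two-element set of endpoints. Edges are abstract objects, so that parallel edges are
  distinct elements of the edge set; loops are excluded.
\<close>

definition finite_multigraph :: "'v set \<Rightarrow> 'e set \<Rightarrow> ('e \<Rightarrow> 'v set) \<Rightarrow> bool" where
  "finite_multigraph V E ends \<longleftrightarrow>
     finite V \<and> finite E \<and> (\<forall>e\<in>E. ends e \<subseteq> V \<and> card (ends e) = 2)"

definition cut :: "'e set \<Rightarrow> ('e \<Rightarrow> 'v set) \<Rightarrow> 'v set \<Rightarrow> 'e set" where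
  "cut E ends S = {e \<in> E. card (ends e \<inter> S) = 1}"

definition graph_connected :: "'v set \<Rightarrow> 'e set \<Rightarrow> ('e \<Rightarrow> 'v set) \<Rightarrow> bool" where
  "graph_connected V E ends \<longleftrightarrow>
     (\<forall>u\<in>V. \<forall>v\<in>V. (u, v) \<in> {(x, y). \<exists>e\<in>E. ends e = {x, y}}\<^sup>*)"

text \<open>
  A graph with a single vertex is \<open>k\<close>-edge-connected for every \<open>k\<close> under this convention.
\<close>

definition edge_connected :: "nat \<Rightarrow> 'v set \<Rightarrow> 'e set \<Rightarrow> ('e \<Rightarrow> 'v set) \<Rightarrow> bool" where
  "edge_connected k V E ends \<longleftrightarrow>
     (\<forall>D\<subseteq>E. card D < k \<longrightarrow> graph_connected V (E - D) ends)"

definition flex_connected ::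
    "nat \<Rightarrow> nat \<Rightarrow> 'v set \<Rightarrow> 'e set \<Rightarrow> ('e \<Rightarrow> 'v set) \<Rightarrow> 'e set \<Rightarrow> bool" where
  "flex_connected p q V E ends U \<longleftrightarrow>
     (\<forall>F\<subseteq>U. card F \<le> q \<longrightarrow> edge_connected p V (E - F) ends)"

definition violated_sets ::
    "nat \<Rightarrow> 'v set \<Rightarrow> 'e set \<Rightarrow> ('e \<Rightarrow> 'v set) \<Rightarrow> 'e set \<Rightarrow> 'v set set" where
  "violated_sets p V E ends U =
     {S. S \<subseteq> V \<and> card (cut E ends S) = p + 2 \<and> card (cut E ends S \<inter> U) \<ge> 3}"

definition crosses :: "'v set \<Rightarrow> 'v set \<Rightarrow> 'v set \<Rightarrow> bool" where
  "crosses V A B \<longleftrightarrow>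
     A - B \<noteq> {} \<and> A \<inter> B \<noteq> {} \<and> B - A \<noteq> {} \<and> V - (A \<union> B) \<noteq> {}"

text \<open>
  The four sets are counted with multiplicity, i.e. at least two of the four expressions denote
  members of the family. Counting distinct sets would make the condition fail for
  \<open>A = B\<close> whenever the empty set is not in the family.
\<close>

definition pliable :: "'v set set \<Rightarrow> bool" where
  "pliable \<F> \<longleftrightarrow>
     (\<forall>A\<in>\<F>. \<forall>B\<in>\<F>. length (filter (\<lambda>S. S \<in> \<F>) [A \<union> B, A \<inter> B, A - B, B - A]) \<ge> 2)"

definition residual :: "('v \<times> 'v) set \<Rightarrow> 'v set set \<Rightarrow> 'v set set" where
  "residual P \<F> = {S \<in> \<F>. \<not> (\<exists>(u, v)\<in>P. (u \<in> S) \<noteq> (v \<in> S))}"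

definition property_gamma :: "'v set \<Rightarrow> 'v set set \<Rightarrow> bool" where
  "property_gamma V \<F> \<longleftrightarrow>
     (\<forall>P \<subseteq> V \<times> V. \<forall>C \<in> residual P \<F>. \<forall>S1 \<in> residual P \<F>. \<forall>S2 \<in> residual P \<F>.
        \<not> (\<exists>D \<in> residual P \<F>. D \<subset> C) \<longrightarrow>
        crosses V C S1 \<longrightarrow> crosses V C S2 \<longrightarrow> S1 \<subseteq> S2 \<longrightarrow>
        S2 - (S1 \<union> C) = {} \<or> S2 - (S1 \<union> C) \<in> \<F>)"

end

(*
  Flex-connectivity says that every proper nonempty S is left by at least p + min 2 u edges, where u
  is the number of unsafe edges leaving S. Let A, B be crossing violated sets. Since p is even, the
  four corners have cut sizes of the same parity. Odd sizes would give two adjacent corners with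
  p + 1 edges, hence at most one unsafe edge each, and so at most two unsafe edges leaving A or B.
  With even sizes, either two opposite corners are violated, or all corners have cut size p + 2, no
  edge joins opposite corners, and the edges between corners form a square with (p + 2) / 2 edges on
  each side; there, counting unsafe edges gives a violated corner in each opposite pair.

  For property gamma, minimality of C leaves only the square for (C, S1) and for (C, S2). Comparing
  the two squares shows that D = S2 - (S1 Un C) has no neighbour in C, and that its cut size is p + 2
  minus twice the number k of edges from S1 - C to V - (S2 Un C). Hence k <= 1, and k = 1 would leave
  D with p edges, some of them unsafe.
*)

theory Submission
  imports Defs
begin

section \<open>Edges between vertex sets\<close>

text \<open>The edge set is a parameter, so one set of additivity rules serves both all edges and
  the unsafe ones.\<close>

definition between :: "'e set \<Rightarrow> ('e \<Rightarrow> 'v set) \<Rightarrow> 'v set \<Rightarrow> 'v set \<Rightarrow> 'e set" where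
  "between F ends X Y = {e \<in> F. \<exists>x\<in>X. \<exists>y\<in>Y. ends e = {x, y}}"

lemma between_commute: "between F ends X Y = between F ends Y X"
  unfolding between_def by (intro Collect_cong) (metis doubleton_eq_iff)

text \<open>An edge counted in both terms would have an endpoint in \<open>Z\<close> lying also in
  \<open>X\<close> or \<open>Y\<close>.\<close>

lemma card_between_Un_right:
  assumes "finite F" "X \<inter> Z = {}" "Y \<inter> Z = {}"
  shows "card (between F ends X (Y \<union> Z)) = card (between F ends X Y) + card (between F ends X Z)"
proof -
  have "between F ends X (Y \<union> Z) = between F ends X Y \<union> between F ends X Z"
    unfolding between_def by blast
  moreover have "between F ends X Y \<inter> between F ends X Z = {}"
    using assms(2,3) unfolding between_def by (auto simp: doubleton_eq_iff)
  moreover have "finite (between F ends X W)" for W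
    using assms(1) unfolding between_def by simp
  ultimately show ?thesis
    by (simp add: card_Un_disjoint)
qed

lemma card_between_Un_left:
  assumes "finite F" "X \<inter> Z = {}" "Y \<inter> Z = {}"
  shows "card (between F ends (Y \<union> Z) X) = card (between F ends Y X) + card (between F ends Z X)"
  using card_between_Un_right[OF assms] by (simp add: between_commute)

text \<open>\<open>T\<close> is tied to \<open>V - S\<close> by an equation so that the complement
  can later be supplied as a union of corners.\<close>

lemma cut_eq_between:
  assumes "finite_multigraph V F ends" "S \<subseteq> V" "T = V - S"
  shows "cut F ends S = between F ends S T"
proof -
  have "card (ends e \<inter> S) = 1 \<longleftrightarrow> (\<exists>x\<in>S. \<exists>y\<in>T. ends e = {x, y})" if "e \<in> F" for e
  proof -
    have "card (ends e) = 2" "ends e \<subseteq> V"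
      using assms(1) that unfolding finite_multigraph_def by auto
    then obtain a b where ab: "ends e = {a, b}" "a \<noteq> b" "a \<in> V" "b \<in> V"
      by (auto simp: card_2_iff)
    have "card ({a, b} \<inter> S) = 1 \<longleftrightarrow> (a \<in> S) \<noteq> (b \<in> S)"
      using ab(2) by (cases "a \<in> S"; cases "b \<in> S") simp_all
    moreover have "(\<exists>x\<in>S. \<exists>y\<in>T. {a, b} = {x, y}) \<longleftrightarrow> a \<in> S \<and> b \<in> T \<or> b \<in> S \<and> a \<in> T"
      unfolding doubleton_eq_iff by blast
    ultimately show ?thesis
      using ab assms(3) by auto
  qed
  then show ?thesis
    unfolding cut_def between_def by blast
qed

section \<open>Cuts in flex-connected graphs\<close>

lemma cut_separates:
  assumes "\<forall>e\<in>E. card (ends e) = 2" "D \<inter> cut E ends S = {}" "D \<subseteq> E"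
    and "(u, v) \<in> {(x, y). \<exists>e\<in>D. ends e = {x, y}}\<^sup>*" "u \<in> S"
  shows "v \<in> S"
  using assms(4)
proof induction
  case base
  then show ?case using assms(5) .
next
  case (step y z)
  then obtain e where e: "e \<in> D" "ends e = {y, z}" by blast
  have "z \<in> S"
  proof (rule ccontr)
    assume "z \<notin> S"
    then have "ends e \<inter> S = {y}" using e step.IH by auto
    then show False using e assms(2,3) unfolding cut_def by auto
  qed
  then show ?case .
qed

text \<open>Delete as many unsafe cut edges as flexibility allows; at least \<open>p\<close> cut
  edges must remain, since otherwise deleting them too would separate \<open>S\<close> from its
  complement.\<close>

lemma flex_connected_card_cut:
  assumes "finite_multigraph V E ends" "U \<subseteq> E" "flex_connected p q V E ends U"
    and "S \<subseteq> V" "S \<noteq> {}" "S \<noteq> V"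
  shows "p + min q (card (cut U ends S)) \<le> card (cut E ends S)"
proof (rule ccontr)
  assume less: "\<not> ?thesis"
  have sub: "cut U ends S \<subseteq> cut E ends S"
    using assms(2) unfolding cut_def by auto
  have fin: "finite (cut E ends S)"
    using assms(1) unfolding finite_multigraph_def cut_def by simp
  obtain F where F: "F \<subseteq> cut U ends S" "card F = min q (card (cut U ends S))"
    using obtain_subset_with_card_n[of "min q (card (cut U ends S))" "cut U ends S"] by auto
  have "F \<subseteq> U" using F(1) unfolding cut_def by auto
  then have conn: "edge_connected p V (E - F) ends"
    using assms(3) F(2) unfolding flex_connected_def by simp
  have "finite F" using F(1) sub fin finite_subset by metis
  then have "card (cut E ends S - F) = card (cut E ends S) - card F"
    using F(1) sub by (intro card_Diff_subset) auto
  \<comment> \<open>For \<open>p = 0\<close> no set has fewer than \<open>p\<close> edges; there the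
    negated goal must clash directly with \<open>F\<close> being part of the cut.\<close>
  moreover have "p > 0 \<or> card (cut E ends S) < card F"
    using less F(2) by auto
  moreover have "card F \<le> card (cut E ends S)"
    using F(1) sub fin by (intro card_mono) auto
  ultimately have "card (cut E ends S - F) < p"
    using less F(2) by linarith
  moreover have "cut E ends S - F \<subseteq> E - F" unfolding cut_def by auto
  ultimately have gc: "graph_connected V (E - F - (cut E ends S - F)) ends"
    using conn unfolding edge_connected_def by blast
  obtain u v where uv: "u \<in> S" "v \<in> V" "v \<notin> S" using assms(4-6) by blast
  have "v \<in> S"
  proof (rule cut_separates)
    show "\<forall>e\<in>E. card (ends e) = 2" using assms(1) unfolding finite_multigraph_def by auto
    show "(u, v) \<in> {(x, y). \<exists>e\<in>E - F - (cut E ends S - F). ends e = {x, y}}\<^sup>*"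
      using gc uv assms(4) unfolding graph_connected_def by blast
  qed (use F(1) sub uv in auto)
  then show False using uv by simp
qed

section \<open>Arithmetic of the four corners\<close>

text \<open>Corners \<open>1, 4\<close> and \<open>2, 3\<close> are opposite; \<open>d\<close> counts edges and \<open>u\<close> unsafe edges.\<close>

lemma corner_degrees:
  fixes p :: nat
  assumes "even p"
    and "d1 + d2 = p + 2 + 2 * x12" "d1 + d3 = p + 2 + 2 * x13"
    and "d1 + d4 + 2 * x23 = 2 * p + 4" "d2 + d3 + 2 * x14 = 2 * p + 4"
    and "3 \<le> u1 + u2" "3 \<le> u1 + u3" "3 \<le> u2 + u4" "3 \<le> u3 + u4"
    and "p + min 2 u1 \<le> d1" "p + min 2 u2 \<le> d2" "p + min 2 u3 \<le> d3" "p + min 2 u4 \<le> d4"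
  shows "d2 = p + 2 \<and> d3 = p + 2 \<and> 3 \<le> u2 \<and> 3 \<le> u3
       \<or> d1 = p + 2 \<and> d4 = p + 2 \<and> 3 \<le> u1 \<and> 3 \<le> u4
       \<or> d1 = p + 2 \<and> d2 = p + 2 \<and> d3 = p + 2 \<and> d4 = p + 2 \<and> x14 = 0 \<and> x23 = 0"
proof (cases "even d1")
  case True
  then have ev: "even d2" "even d3" "even d4"
    using assms(1-4) by (metis even_add even_numeral even_mult_iff)+
  \<comment> \<open>Parity excludes \<open>p + 1\<close>, so a corner with any unsafe edge has at
    least \<open>p + 2\<close> edges.\<close>
  have deg: "d = p \<and> w = 0 \<or> p + 2 \<le> d" if "even d" "p + min 2 w \<le> d" for d w
  proof -
    have "d \<noteq> p + 1" using that(1) assms(1) by auto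
    then show ?thesis using that(2) by linarith
  qed
  consider "d1 = p" "u1 = 0" | "d4 = p" "u4 = 0" | "p + 2 \<le> d1" "p + 2 \<le> d4"
    using deg[OF True assms(10)] deg[OF ev(3) assms(13)] by blast
  then show ?thesis
  proof cases
    \<comment> \<open>\<open>u1 = 0\<close> forces \<open>u2\<close> and \<open>u3\<close> to be at
      least 3, so \<open>d2\<close> and \<open>d3\<close> are at least \<open>p + 2\<close>; their
      sum is at most \<open>2 * p + 4\<close>, so both are tight.\<close>
    case 1
    then show ?thesis
      using deg[OF ev(1) assms(11)] deg[OF ev(2) assms(12)] assms(5,6,7) by linarith
  next
    case 2
    then show ?thesis
      using deg[OF ev(1) assms(11)] deg[OF ev(2) assms(12)] assms(5,8,9) by linarith
  next
    case 3
    then have "d1 = p + 2" "d4 = p + 2" "x23 = 0" using assms(4) by linarith+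
    then show ?thesis
      using deg[OF ev(1) assms(11)] deg[OF ev(2) assms(12)] assms(5-9) by linarith
  qed
next
  case False
  then have od: "odd d2" "odd d3" "odd d4"
    using assms(1-4) by (metis even_add even_numeral even_mult_iff)+
  \<comment> \<open>Parity excludes \<open>p + 2\<close>, so two unsafe edges force
    \<open>p + 3\<close>, which opposite corners cannot both reach.\<close>
  have deg: "w \<le> 1 \<or> p + 3 \<le> d" if "odd d" "p + min 2 w \<le> d" for d w
  proof -
    have "d \<noteq> p + 2" using that(1) assms(1) by auto
    then show ?thesis using that(2) by linarith
  qed
  have "u1 \<le> 1 \<or> u4 \<le> 1"
    using deg[OF False assms(10)] deg[OF od(3) assms(13)] assms(4) by linarith
  moreover have "u2 \<le> 1 \<or> u3 \<le> 1"
    using deg[OF od(1) assms(11)] deg[OF od(2) assms(12)] assms(5) by linarith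
  \<comment> \<open>One of the corners 1, 4 and one of 2, 3 are always adjacent.\<close>
  ultimately show ?thesis using assms(6-9) by linarith
qed

section \<open>Crossing violated sets\<close>

locale flex_multigraph =
  fixes V :: "'v set" and E U :: "'e set" and ends :: "'e \<Rightarrow> 'v set" and p :: nat
  assumes graph: "finite_multigraph V E ends"
    and unsafe: "U \<subseteq> E"
    and even_p: "even p"
    and flex: "flex_connected p 2 V E ends U"
begin

abbreviation e :: "'v set \<Rightarrow> 'v set \<Rightarrow> nat" where "e X Y \<equiv> card (between E ends X Y)"
abbreviation u :: "'v set \<Rightarrow> 'v set \<Rightarrow> nat" where "u X Y \<equiv> card (between U ends X Y)"
abbreviation viol :: "'v set set" where "viol \<equiv> violated_sets p V E ends U"

lemma finite_edges: "finite E" "finite U"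
  using graph unsafe finite_subset unfolding finite_multigraph_def by auto

lemma graph_unsafe: "finite_multigraph V U ends"
  using graph unsafe finite_edges unfolding finite_multigraph_def by auto

lemma u_le_e: "u X Y \<le> e X Y"
  using unsafe finite_edges unfolding between_def by (intro card_mono) auto

lemmas count_Un =
  card_between_Un_left[OF finite_edges(1)] card_between_Un_left[OF finite_edges(2)]
  card_between_Un_right[OF finite_edges(1)] card_between_Un_right[OF finite_edges(2)]

lemma violated_iff:
  assumes "S \<subseteq> V" "T = V - S"
  shows "S \<in> viol \<longleftrightarrow> e S T = p + 2 \<and> 3 \<le> u S T"
proof -
  have "cut E ends S \<inter> U = cut U ends S"
    using unsafe unfolding cut_def by auto
  then show ?thesis
    using assms cut_eq_between[OF graph assms] cut_eq_between[OF graph_unsafe assms]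
    unfolding violated_sets_def by simp
qed

lemma violated_subset: "S \<in> viol \<Longrightarrow> S \<subseteq> V"
  unfolding violated_sets_def by simp

text \<open>Both sides have the same cut. This lets the outer corner
  \<open>V - (A \<union> B)\<close> stand for \<open>A \<union> B\<close>.\<close>

lemma violated_Compl: "S \<subseteq> V \<Longrightarrow> V - S \<in> viol \<longleftrightarrow> S \<in> viol"
  using violated_iff[of S "V - S"] violated_iff[of "V - S" S]
  by (auto simp: between_commute[of _ _ "V - S" S])

lemma flex_bound:
  assumes "S \<subseteq> V" "T = V - S" "S \<noteq> {}" "T \<noteq> {}"
  shows "p + min 2 (u S T) \<le> e S T"
  using flex_connected_card_cut[OF graph unsafe flex assms(1)] assms
    cut_eq_between[OF graph assms(1,2)] cut_eq_between[OF graph_unsafe assms(1,2)]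
  by auto

text \<open>The case \<open>square\<close> leaves open which corners are violated: pliability needs
  one from each opposite pair, while property gamma uses that those inside one set are not.\<close>

lemma crossing_violated:
  assumes A: "A \<in> viol" and B: "B \<in> viol" and "crosses V A B"
  defines "R \<equiv> V - (A \<union> B)"
  obtains
    (diff) "A - B \<in> viol" "B - A \<in> viol"
  | (inter) "A \<inter> B \<in> viol" "A \<union> B \<in> viol"
  | (square) "e (A \<inter> B) R = 0" "e (A - B) (B - A) = 0"
      "2 * e (A \<inter> B) (A - B) = p + 2" "2 * e (A \<inter> B) (B - A) = p + 2"
      "2 * e (A - B) R = p + 2" "2 * e (B - A) R = p + 2"
      "3 \<le> u (A \<inter> B) (B - A) + u (A - B) R" "3 \<le> u (A \<inter> B) (A - B) + u (B - A) R"
      "A \<inter> B \<in> viol \<longleftrightarrow> 3 \<le> u (A \<inter> B) (A - B) + u (A \<inter> B) (B - A)"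
      "A - B \<in> viol \<longleftrightarrow> 3 \<le> u (A \<inter> B) (A - B) + u (A - B) R"
      "B - A \<in> viol \<longleftrightarrow> 3 \<le> u (A \<inter> B) (B - A) + u (B - A) R"
      "A \<union> B \<in> viol \<longleftrightarrow> 3 \<le> u (A - B) R + u (B - A) R"
proof -
  define Q1 Q2 Q3 where Q: "Q1 = A \<inter> B" "Q2 = A - B" "Q3 = B - A"
  have sub: "A \<subseteq> V" "B \<subseteq> V" using A B violated_subset by auto
  have disj: "Q1 \<inter> Q2 = {}" "Q1 \<inter> Q3 = {}" "Q2 \<inter> Q3 = {}" "Q1 \<inter> R = {}" "Q2 \<inter> R = {}" "Q3 \<inter> R = {}"
    "Q2 \<inter> Q1 = {}" "Q3 \<inter> Q1 = {}" "Q3 \<inter> Q2 = {}" "R \<inter> Q1 = {}" "R \<inter> Q2 = {}" "R \<inter> Q3 = {}"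
    unfolding Q R_def by auto
  have ne: "Q1 \<noteq> {}" "Q2 \<noteq> {}" "Q3 \<noteq> {}" "R \<noteq> {}"
    using assms(3) unfolding crosses_def Q R_def by auto
  have V: "Q1 \<subseteq> V" "Q2 \<subseteq> V" "Q3 \<subseteq> V" "R \<subseteq> V"
    and co: "Q2 \<union> (Q3 \<union> R) = V - Q1" "Q1 \<union> (Q3 \<union> R) = V - Q2"
      "Q1 \<union> (Q2 \<union> R) = V - Q3" "Q1 \<union> (Q2 \<union> Q3) = V - R"
    and AB: "A = Q1 \<union> Q2" "B = Q1 \<union> Q3" "V - A = Q3 \<union> R" "V - B = Q2 \<union> R"
    using sub unfolding Q R_def by auto
  note comm = between_commute[of _ ends Q2 Q1] between_commute[of _ ends Q3 Q1]
    between_commute[of _ ends Q3 Q2] between_commute[of _ ends R Q1]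
    between_commute[of _ ends R Q2] between_commute[of _ ends R Q3]
  note cnt = count_Un disj comm Int_Un_distrib Int_Un_distrib2
  have vA: "e Q1 Q3 + e Q1 R + e Q2 Q3 + e Q2 R = p + 2"
    "3 \<le> u Q1 Q3 + u Q1 R + u Q2 Q3 + u Q2 R"
    using A violated_iff[OF sub(1) AB(3)[symmetric]] by (simp_all add: AB(1) cnt)
  have vB: "e Q1 Q2 + e Q1 R + e Q2 Q3 + e Q3 R = p + 2"
    "3 \<le> u Q1 Q2 + u Q1 R + u Q2 Q3 + u Q3 R"
    using B violated_iff[OF sub(2) AB(4)[symmetric]] by (simp_all add: AB(2) cnt)
  note viol = violated_iff[OF V(1) co(1)] violated_iff[OF V(2) co(2)]
    violated_iff[OF V(3) co(3)] violated_iff[OF V(4) co(4)]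
  have "R \<in> viol \<longleftrightarrow> A \<union> B \<in> viol"
    using violated_Compl[of "A \<union> B"] sub unfolding R_def by auto
  note viol' = viol(1-3) viol(4)[unfolded this]
  have bounds: "p + min 2 (u Q1 (Q2 \<union> (Q3 \<union> R))) \<le> e Q1 (Q2 \<union> (Q3 \<union> R))"
    "p + min 2 (u Q2 (Q1 \<union> (Q3 \<union> R))) \<le> e Q2 (Q1 \<union> (Q3 \<union> R))"
    "p + min 2 (u Q3 (Q1 \<union> (Q2 \<union> R))) \<le> e Q3 (Q1 \<union> (Q2 \<union> R))"
    "p + min 2 (u R (Q1 \<union> (Q2 \<union> Q3))) \<le> e R (Q1 \<union> (Q2 \<union> Q3))"
    using flex_bound[OF V(1) co(1)] flex_bound[OF V(2) co(2)] flex_bound[OF V(3) co(3)]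
      flex_bound[OF V(4) co(4)] ne by blast+
  have deg: "e Q1 (Q2 \<union> (Q3 \<union> R)) = e Q1 Q2 + (e Q1 Q3 + e Q1 R)"
    "e Q2 (Q1 \<union> (Q3 \<union> R)) = e Q1 Q2 + (e Q2 Q3 + e Q2 R)"
    "e Q3 (Q1 \<union> (Q2 \<union> R)) = e Q1 Q3 + (e Q2 Q3 + e Q3 R)"
    "e R (Q1 \<union> (Q2 \<union> Q3)) = e Q1 R + (e Q2 R + e Q3 R)"
    "u Q1 (Q2 \<union> (Q3 \<union> R)) = u Q1 Q2 + (u Q1 Q3 + u Q1 R)"
    "u Q2 (Q1 \<union> (Q3 \<union> R)) = u Q1 Q2 + (u Q2 Q3 + u Q2 R)"
    "u Q3 (Q1 \<union> (Q2 \<union> R)) = u Q1 Q3 + (u Q2 Q3 + u Q3 R)"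
    "u R (Q1 \<union> (Q2 \<union> Q3)) = u Q1 R + (u Q2 R + u Q3 R)"
    by (simp_all add: cnt)
  note corner = corner_degrees[OF even_p _ _ _ _ _ _ _ _ bounds,
      of "e Q1 Q2" "e Q1 Q3" "e Q2 Q3" "e Q1 R", unfolded deg]
  have cases: "Q2 \<in> viol \<and> Q3 \<in> viol \<or> Q1 \<in> viol \<and> A \<union> B \<in> viol
     \<or> e Q1 (Q2 \<union> (Q3 \<union> R)) = p + 2 \<and> e Q2 (Q1 \<union> (Q3 \<union> R)) = p + 2
       \<and> e Q3 (Q1 \<union> (Q2 \<union> R)) = p + 2 \<and> e R (Q1 \<union> (Q2 \<union> Q3)) = p + 2 \<and> e Q1 R = 0 \<and> e Q2 Q3 = 0"
  proof -
    have "3 \<le> u Q1 Q2 + (u Q1 Q3 + u Q1 R) + (u Q1 Q2 + (u Q2 Q3 + u Q2 R))"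
      "3 \<le> u Q1 Q2 + (u Q1 Q3 + u Q1 R) + (u Q1 Q3 + (u Q2 Q3 + u Q3 R))"
      "3 \<le> u Q1 Q2 + (u Q2 Q3 + u Q2 R) + (u Q1 R + (u Q2 R + u Q3 R))"
      "3 \<le> u Q1 Q3 + (u Q2 Q3 + u Q3 R) + (u Q1 R + (u Q2 R + u Q3 R))"
      using vA(2) vB(2) by linarith+
    note corner[OF _ _ _ _ this]
    \<comment> \<open>The first two equations count the edges leaving
      \<open>A = Q1 \<union> Q2\<close> and \<open>B = Q1 \<union> Q3\<close>; the last two express
      the sum of both cut sizes through each opposite pair.\<close>
    moreover have "e Q1 Q2 + (e Q1 Q3 + e Q1 R) + (e Q1 Q2 + (e Q2 Q3 + e Q2 R)) = p + 2 + 2 * e Q1 Q2"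
      "e Q1 Q2 + (e Q1 Q3 + e Q1 R) + (e Q1 Q3 + (e Q2 Q3 + e Q3 R)) = p + 2 + 2 * e Q1 Q3"
      "e Q1 Q2 + (e Q1 Q3 + e Q1 R) + (e Q1 R + (e Q2 R + e Q3 R)) + 2 * e Q2 Q3 = 2 * p + 4"
      "e Q1 Q2 + (e Q2 Q3 + e Q2 R) + (e Q1 Q3 + (e Q2 Q3 + e Q3 R)) + 2 * e Q1 R = 2 * p + 4"
      using vA(1) vB(1) by linarith+
    ultimately show ?thesis
      unfolding viol' deg by argo
  qed
  then consider "Q2 \<in> viol" "Q3 \<in> viol" | "Q1 \<in> viol" "A \<union> B \<in> viol"
    | (sq) "e Q1 (Q2 \<union> (Q3 \<union> R)) = p + 2" "e Q2 (Q1 \<union> (Q3 \<union> R)) = p + 2"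
      "e Q3 (Q1 \<union> (Q2 \<union> R)) = p + 2" "e R (Q1 \<union> (Q2 \<union> Q3)) = p + 2" "e Q1 R = 0" "e Q2 Q3 = 0"
    by argo
  then show thesis
  proof cases
    case 1
    then show thesis using diff unfolding Q by blast
  next
    case 2
    then show thesis using inter unfolding Q by blast
  next
    case sq
    have "u Q1 R = 0" "u Q2 Q3 = 0"
      using u_le_e[of Q1 R] u_le_e[of Q2 Q3] sq by auto
    note z = this sq(5,6)
    have eqs: "e Q1 Q2 + e Q1 Q3 = p + 2" "e Q1 Q2 + e Q2 R = p + 2" "e Q1 Q3 + e Q3 R = p + 2"
      "e Q2 R + e Q3 R = p + 2"
      using sq unfolding deg by simp_all
    show thesis
    proof (rule square, fold Q)
      show "e Q1 R = 0" "e Q2 Q3 = 0" by fact+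
      \<comment> \<open>Equal degrees of \<open>Q1\<close> and \<open>Q2\<close> give
        \<open>e Q1 Q3 = e Q2 R\<close>, and these two add up to the cut of \<open>A\<close>; the
        other sides follow.\<close>
      show "2 * e Q1 Q2 = p + 2" "2 * e Q1 Q3 = p + 2" "2 * e Q2 R = p + 2" "2 * e Q3 R = p + 2"
        using eqs vA vB z by linarith+
      show "3 \<le> u Q1 Q3 + u Q2 R" "3 \<le> u Q1 Q2 + u Q3 R"
        using vA vB z by linarith+
      show "Q1 \<in> viol \<longleftrightarrow> 3 \<le> u Q1 Q2 + u Q1 Q3" "Q2 \<in> viol \<longleftrightarrow> 3 \<le> u Q1 Q2 + u Q2 R"
        "Q3 \<in> viol \<longleftrightarrow> 3 \<le> u Q1 Q3 + u Q3 R" "A \<union> B \<in> viol \<longleftrightarrow> 3 \<le> u Q2 R + u Q3 R"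
        unfolding viol' using sq(1-4) z by (simp_all add: deg)
    qed
  qed
qed

section \<open>Pliability\<close>

text \<open>Without crossing, one of the four regions is empty, and two of the four sets are
  \<open>A\<close> and \<open>B\<close> or their complements.\<close>

theorem pliable_violated: "pliable viol"
  unfolding pliable_def
proof (intro ballI)
  fix A B assume A: "A \<in> viol" and B: "B \<in> viol"
  have sub: "A \<subseteq> V" "B \<subseteq> V" using A B violated_subset by auto
  show "2 \<le> length (filter (\<lambda>S. S \<in> viol) [A \<union> B, A \<inter> B, A - B, B - A])"
  proof (cases "crosses V A B")
    case True
    from A B True show ?thesis
    proof (cases rule: crossing_violated)
      case square
      \<comment> \<open>Over each opposite pair the unsafe counts total at least six, so one corner
        of the pair has three.\<close>
      then show ?thesis by auto
    qed auto
  next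
    case False
    then consider "A - B = {}" | "A \<inter> B = {}" | "B - A = {}" | "V \<subseteq> A \<union> B"
      unfolding crosses_def by blast
    then show ?thesis
    proof cases
      case 1
      then have "A \<union> B = B" "A \<inter> B = A" by auto
      then show ?thesis using A B by simp
    next
      case 2
      then have "A - B = A" "B - A = B" by auto
      then show ?thesis using A B by simp
    next
      case 3
      then have "A \<union> B = A" "A \<inter> B = B" by auto
      then show ?thesis using A B by simp
    next
      case 4
      then have "A - B = V - B" "B - A = V - A" using sub by auto
      then show ?thesis using A B violated_Compl sub by simp
    qed
  qed
qed

section \<open>Property gamma\<close>

lemma crossing_minimal:
  assumes "C \<in> viol" "S \<in> viol" "crosses V C S" "C \<inter> S \<notin> viol" "C - S \<notin> viol"
  defines "R \<equiv> V - (C \<union> S)"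
  shows "e (C \<inter> S) R = 0" "e (C - S) (S - C) = 0"
    "2 * e (C \<inter> S) (S - C) = p + 2" "2 * e (S - C) R = p + 2" "3 \<le> u (S - C) R"
proof -
  have "e (C \<inter> S) R = 0 \<and> e (C - S) (S - C) = 0 \<and>
    2 * e (C \<inter> S) (S - C) = p + 2 \<and> 2 * e (S - C) R = p + 2 \<and> 3 \<le> u (S - C) R"
    using assms(1-3)
  proof (cases rule: crossing_violated)
    case square
    have "u (C \<inter> S) (C - S) + u (C \<inter> S) (S - C) < 3" "u (C \<inter> S) (C - S) + u (C - S) R < 3"
      using square(9,10) assms(4,5) unfolding R_def by linarith+
    \<comment> \<open>Adding the two upper bounds and using the lower bound for the cut of
      \<open>C\<close> gives \<open>u (C \<inter> S) (C - S) = 0\<close>.\<close>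
    then have "3 \<le> u (S - C) R"
      using square(7,8) unfolding R_def by linarith
    then show ?thesis
      using square(1,2,4,6) unfolding R_def by blast
  qed (use assms(4,5) in blast)+
  then show "e (C \<inter> S) R = 0" "e (C - S) (S - C) = 0"
    "2 * e (C \<inter> S) (S - C) = p + 2" "2 * e (S - C) R = p + 2" "3 \<le> u (S - C) R"
    by blast+
qed

theorem property_gamma_violated: "property_gamma V viol"
  unfolding property_gamma_def
proof (intro allI impI ballI)
  fix P C S1 S2
  assume mem: "C \<in> residual P viol" "S1 \<in> residual P viol" "S2 \<in> residual P viol"
    and minimal: "\<not> (\<exists>D\<in>residual P viol. D \<subset> C)"
    and cr: "crosses V C S1" "crosses V C S2" and S12: "S1 \<subseteq> S2"
  have v: "C \<in> viol" "S1 \<in> viol" "S2 \<in> viol" using mem unfolding residual_def by auto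
  have min': "C \<inter> S \<notin> viol \<and> C - S \<notin> viol" if S: "S \<in> residual P viol" "crosses V C S" for S
  proof -
    \<comment> \<open>A pair in \<open>P\<close> split by neither \<open>C\<close> nor
      \<open>S\<close> is not split by \<open>C \<inter> S\<close> or \<open>C - S\<close>.\<close>
    have "X \<in> residual P viol" if "X \<in> viol" "X = C \<inter> S \<or> X = C - S" for X
      using that mem(1) S(1) unfolding residual_def by blast
    moreover have "C \<inter> S \<subset> C" "C - S \<subset> C" using S(2) unfolding crosses_def by auto
    ultimately show ?thesis using minimal by blast
  qed
  note sq1 = crossing_minimal[OF v(1,2) cr(1) conjunct1 conjunct2, OF min' min',
      OF mem(2) cr(1) mem(2) cr(1)]
  note sq2 = crossing_minimal[OF v(1,3) cr(2) conjunct1 conjunct2, OF min' min',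
      OF mem(3) cr(2) mem(3) cr(2)]
  \<comment> \<open>The chain \<open>S1 \<subseteq> S2\<close> cuts both \<open>C\<close> and its
    complement into three parts.\<close>
  define C1 C2 C3 D1 D2 D3 where Q: "C1 = C \<inter> S1" "C2 = C \<inter> S2 - S1" "C3 = C - S2"
    "D1 = S1 - C" "D2 = S2 - (S1 \<union> C)" "D3 = V - (C \<union> S2)"
  have sub: "C \<subseteq> V" "S1 \<subseteq> V" "S2 \<subseteq> V" using v violated_subset by auto
  have parts: "V - (C \<union> S1) = D2 \<union> D3" "C - S1 = C2 \<union> C3" "C \<inter> S2 = C1 \<union> C2" "S2 - C = D1 \<union> D2"
    using S12 sub unfolding Q by auto
  have disj: "C1 \<inter> D1 = {}" "C1 \<inter> D2 = {}" "C1 \<inter> D3 = {}" "C2 \<inter> D1 = {}" "C2 \<inter> D2 = {}"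
    "C2 \<inter> D3 = {}" "C3 \<inter> D1 = {}" "C3 \<inter> D2 = {}" "C3 \<inter> D3 = {}"
    "C1 \<inter> C2 = {}" "C1 \<inter> C3 = {}" "C2 \<inter> C3 = {}" "D1 \<inter> D2 = {}" "D1 \<inter> D3 = {}" "D2 \<inter> D3 = {}"
    using S12 unfolding Q by auto
  note cnt = count_Un disj disj[THEN Int_commute[THEN trans]] Int_Un_distrib Int_Un_distrib2
  note sq1' = sq1[unfolded parts, folded Q] and sq2' = sq2[unfolded parts, folded Q]
  have 1: "e C1 D2 = 0" "e C2 D1 = 0" "2 * e C1 D1 = p + 2"
    "2 * (e D1 D2 + e D1 D3) = p + 2" "3 \<le> u D1 D2 + u D1 D3"
    using sq1' by (simp_all add: cnt)
  have 2: "e C3 D2 = 0" "2 * (e C1 D1 + e C2 D1 + (e C1 D2 + e C2 D2)) = p + 2"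
    "2 * (e D1 D3 + e D2 D3) = p + 2" "3 \<le> u D1 D3 + u D2 D3"
    using sq2' by (simp_all add: cnt)
  \<comment> \<open>By the square for \<open>S1\<close>, \<open>e C1 D1\<close> alone is already
    \<open>(p + 2) / 2\<close>, the whole side of the square for \<open>S2\<close>.\<close>
  have C2D2: "e C2 D2 = 0" using 1 2(2) by simp
  have D2: "D2 \<subseteq> V" and co: "C1 \<union> (C2 \<union> (C3 \<union> (D1 \<union> D3))) = V - D2"
    using sub S12 unfolding Q by auto
  let ?T = "C1 \<union> (C2 \<union> (C3 \<union> (D1 \<union> D3)))"
  have comm: "between F ends D2 X = between F ends X D2" for F X
    by (rule between_commute)
  have deg: "e D2 ?T = e C1 D2 + (e C2 D2 + (e C3 D2 + (e D1 D2 + e D2 D3)))"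
    "u D2 ?T = u C1 D2 + (u C2 D2 + (u C3 D2 + (u D1 D2 + u D2 D3)))"
    by (simp_all add: cnt comm[of _ C1] comm[of _ C2] comm[of _ C3] comm[of _ D1])
  show "S2 - (S1 \<union> C) = {} \<or> S2 - (S1 \<union> C) \<in> viol"
  proof (cases "D2 = {}")
    case False
    \<comment> \<open>This makes the complement of \<open>D2\<close> nonempty, as
      \<open>flex_bound\<close> requires.\<close>
    have "D1 \<noteq> {}" using cr(1) unfolding crosses_def Q by auto
    then have bound: "p + min 2 (u D2 ?T) \<le> e D2 ?T"
      using flex_bound[OF D2 co] False by blast
    \<comment> \<open>Only \<open>D1\<close> and \<open>D3\<close> are joined to \<open>D2\<close>;
      add the sides \<open>1(4)\<close> and \<open>2(3)\<close>.\<close>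
    have "e D2 ?T + 2 * e D1 D3 = p + 2" using deg(1) C2D2 1(1,4) 2(1,3) by simp
    moreover have "u D1 D3 \<le> e D1 D3" by (rule u_le_e)
    \<comment> \<open>If \<open>e D1 D3 = 1\<close>, then \<open>1(5)\<close> and
      \<open>2(4)\<close> leave at least four unsafe edges at \<open>D2\<close>, against a cut of
      size \<open>p\<close>.\<close>
    ultimately have "e D2 ?T = p + 2" "3 \<le> u D2 ?T"
      using bound deg 1(5) 2(4) by linarith+
    then show ?thesis using violated_iff[OF D2 co] unfolding Q by blast
  qed (simp add: Q)
qed

end

theorem theorem1:
  fixes V :: "'v set" and E U :: "'e set" and ends :: "'e \<Rightarrow> 'v set" and p :: nat
  assumes "finite_multigraph V E ends"
    and "U \<subseteq> E"
    and "p \<ge> 2"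
    and "even p"
    and "flex_connected p 2 V E ends U"
  shows "pliable (violated_sets p V E ends U) \<and>
         property_gamma V (violated_sets p V E ends U)"
proof -
  interpret flex_multigraph V E U ends p
    using assms by unfold_locales
  show ?thesis using pliable_violated property_gamma_violated by blast
qed

end
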